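(* Let $\mathfrak{g}$ be a Lie superalgebra in characteristic $2$ and $M$ a $\mathfrak{g}$-module. The maps $\mathfrak{d}^n:XC^n(\mathfrak{g};M)\to XC^{n+1}(\mathfrak{g};M)$ are well defined. Moreover, for all integers $n\ge -1$, $$\mathfrak{d}^{n+1}\circ\mathfrak{d}^n=0.$$ Hence the pair $(XC^*(\mathfrak{g};M),\mathfrak{d}^* )$ defines a cohomology complex for Lie superalgebras in characteristic $2$.
   Context: All vector spaces are over a field $\mathbb{K}$ of characteristic $2$. Lie superalgebra in characteristic 2: a superspace $\mathfrak{g}=\mathfrak{g}_{\bar 0}\oplus\mathfrak{g}_{\bar 1}$ such that $\mathfrak{g}_{\bar 0}$ is an ordinary Lie algebra, $\mathfrak{g}_{\bar 1}$ is a $\mathfrak{g}_{\bar 0}$-module made two-sided by symmetry (action also denoted $[\cdot,\cdot]$), with a map $s:\mathfrak{g}_{\bar 1}\to\mathfrak{g}_{\bar 0}$, $s(\lambda x)=\lambda^2s(x)$, such that $[x,y]:=s(x+y)+s(x)+s(y)$ is bilinear on $\mathfrak{g}_{\bar 1}$ (the bracket of odd elements), and $[s(x),y]=[x,[x,y]]$ for $x\in\mathfrak{g}_{\bar 1}$, $y\in\mathfrak{g}$. A $\mathfrak{g}$-module is a superspace $M$ with an even linear $\rho:\mathfrak{g}\to\mathfrak{gl}(M)$ such that $\rho([x,y])=\rho(x)\rho(y)+\rho(y)\rho(x)$ and $\rho(s(x))=\rho(x)^2$ for $x$ odd; write $x\cdot m=\rho(x)m$. Cochains: $XC^{-1}:=\{0\}$,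 $XC^0:=M$, $XC^1:=$ linear maps $c:\mathfrak{g}\to M$. For $n\ge 2$, $XC^n(\mathfrak{g};M)$ is the set of pairs $(c,\mathfrak{p})$ with $c:\wedge^n\mathfrak{g}\to M$ multilinear (i.e. alternating $n$-linear), $\mathfrak{p}:\mathfrak{g}_{\bar 1}\times\wedge^{n-2}\mathfrak{g}\to M$ such that $\mathfrak{p}(\lambda x,z)=\lambda^2\mathfrak{p}(x,z)$, $z\mapsto\mathfrak{p}(x,z)$ is multilinear, and $\mathfrak{p}(x+y,z)+\mathfrak{p}(x,z)+\mathfrak{p}(y,z)=c(x,y,z)$ for all $x,y\in\mathfrak{g}_{\bar 1}$, $z\in\wedge^{n-2}\mathfrak{g}$ (for $n=2$, $\mathfrak{p}$ is just a map $\mathfrak{g}_{\bar 1}\to M$). Differentials (hats denote omission): $\mathfrak{d}^{-1}=0$; $\mathfrak{d}^0(m)(x)=x\cdot m$; $\mathfrak{d}^1(c)=(dc,\mathfrak{q})$ with $dc(x,z)=c([x,z])+x\cdot c(z)+z\cdot c(x)$ for $x,z\in\mathfrak{g}$ and $\mathfrak{q}(x)=c(s(x))+x\cdot c(x)$ for $x\in\mathfrak{g}_{\bar 1}$; for $n\ge2$, $\mathfrak{d}^n(c,\mathfrak{p})=(d^nc,d^n\mathfrak{p})$ with $$d^nc(z_1,\dots,z_{n+1})=\sum_{1\le i\le n+1}z_i\cdot c(z_1,\dots,\hat z_i,\dots,z_{n+1})+\sum_{1\le i<j\le n+1}c([z_i,z_j],z_1,\dots,\hat z_i,\dots,\hat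 z_j,\dots,z_{n+1}),$$ $$d^n\mathfrak{p}(x,z_1,\dots,z_{n-1})=x\cdot c(x,z_1,\dots,z_{n-1})+\sum_{1\le i\le n-1}z_i\cdot\mathfrak{p}(x,z_1,\dots,\hat z_i,\dots,z_{n-1})+c(s(x),z_1,\dots,z_{n-1})$$ $$+\sum_{1\le i\le n-1}c([x,z_i],x,z_1,\dots,\hat z_i,\dots,z_{n-1})+\sum_{1\le i<j\le n-1}\mathfrak{p}(x,[z_i,z_j],z_1,\dots,\hat z_i,\dots,\hat z_j,\dots,z_{n-1}).$$ *)

theory Defs
  imports
    "HOL-Computational_Algebra.Computational_Algebra"
    "HOL-Library.Function_Algebras"
    "HOL-Library.Product_Plus"
begin

section \<open>Superspaces, Lie superalgebras in characteristic 2, and modules\<close>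

locale superspace = vector_space scale
  for scale :: "'k::field \<Rightarrow> 'v::ab_group_add \<Rightarrow> 'v" +
  fixes V0 V1 :: "'v set"
  assumes subspace_even: "subspace V0"
    and subspace_odd: "subspace V1"
    and sum_even_odd: "\<exists>a\<in>V0. \<exists>b\<in>V1. v = a + b"
    and even_Int_odd: "V0 \<inter> V1 = {0}"

text \<open>The bracket on \<open>\<gg>\<^sub>0\<close>, the action of \<open>\<gg>\<^sub>0\<close> on \<open>\<gg>\<^sub>1\<close> and the bracket of odd elements
  are combined into one bilinear map \<open>br\<close> on the whole superspace. The values of the squaring \<open>s\<close>
  outside \<open>\<gg>\<^sub>1\<close> are irrelevant.\<close>

locale lie_superalgebra = superspace scale g0 g1
  for scale :: "'k::field \<Rightarrow> 'g::ab_group_add \<Rightarrow> 'g" and g0 g1 :: "'g set" +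
  fixes br :: "'g \<Rightarrow> 'g \<Rightarrow> 'g" and s :: "'g \<Rightarrow> 'g"
  assumes char_2: "CHAR('k) = 2"
    and br_linear_right: "Vector_Spaces.linear scale scale (\<lambda>y. br x y)"
    and br_linear_left: "Vector_Spaces.linear scale scale (\<lambda>x. br x y)"
    and even_closed: "\<lbrakk>x \<in> g0; y \<in> g0\<rbrakk> \<Longrightarrow> br x y \<in> g0"
    and even_alternating: "x \<in> g0 \<Longrightarrow> br x x = 0"
    and even_jacobi: "\<lbrakk>x \<in> g0; y \<in> g0; z \<in> g0\<rbrakk> \<Longrightarrow> br x (br y z) + br y (br z x) + br z (br x y) = 0"
    and action_closed: "\<lbrakk>x \<in> g0; y \<in> g1\<rbrakk> \<Longrightarrow> br x y \<in> g1"
    and action_module: "\<lbrakk>x \<in> g0; y \<in> g0; z \<in> g1\<rbrakk> \<Longrightarrow> br (br x y) z = br x (br y z) - br y (br x z)"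
    and action_two_sided: "\<lbrakk>x \<in> g0; y \<in> g1\<rbrakk> \<Longrightarrow> br y x = br x y"
    and squaring_even: "x \<in> g1 \<Longrightarrow> s x \<in> g0"
    and squaring_scale: "x \<in> g1 \<Longrightarrow> s (scale a x) = scale (a\<^sup>2) (s x)"
    and odd_bracket: "\<lbrakk>x \<in> g1; y \<in> g1\<rbrakk> \<Longrightarrow> br x y = s (x + y) + s x + s y"
    and squaring_bracket: "x \<in> g1 \<Longrightarrow> br (s x) y = br x (br x y)"

locale lie_superalgebra_module =
  lie_superalgebra scale g0 g1 br s + M: superspace scaleM M0 M1
  for scale :: "'k::field \<Rightarrow> 'g::ab_group_add \<Rightarrow> 'g" and g0 g1 :: "'g set"
    and br :: "'g \<Rightarrow> 'g \<Rightarrow> 'g" and s :: "'g \<Rightarrow> 'g"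
    and scaleM :: "'k \<Rightarrow> 'm::ab_group_add \<Rightarrow> 'm" and M0 M1 :: "'m set" +
  fixes \<rho> :: "'g \<Rightarrow> 'm \<Rightarrow> 'm"
  assumes rho_endomorphism: "Vector_Spaces.linear scaleM scaleM (\<rho> x)"
    and rho_linear: "Vector_Spaces.linear scale scaleM (\<lambda>x. \<rho> x m)"
    and rho_even_even: "\<lbrakk>x \<in> g0; m \<in> M0\<rbrakk> \<Longrightarrow> \<rho> x m \<in> M0"
    and rho_even_odd: "\<lbrakk>x \<in> g0; m \<in> M1\<rbrakk> \<Longrightarrow> \<rho> x m \<in> M1"
    and rho_odd_even: "\<lbrakk>x \<in> g1; m \<in> M0\<rbrakk> \<Longrightarrow> \<rho> x m \<in> M1"
    and rho_odd_odd: "\<lbrakk>x \<in> g1; m \<in> M1\<rbrakk> \<Longrightarrow> \<rho> x m \<in> M0"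
    and rho_bracket: "\<rho> (br x y) m = \<rho> x (\<rho> y m) + \<rho> y (\<rho> x m)"
    and rho_squaring: "x \<in> g1 \<Longrightarrow> \<rho> (s x) m = \<rho> x (\<rho> x m)"


section \<open>Cochains\<close>

text \<open>Cochains of all degrees live in one type of pairs \<open>(c, p)\<close>. A function of \<open>k\<close> arguments
  in \<open>\<gg>\<close> is a function on lists, required to vanish on lists of length other than \<open>k\<close>; similarly
  \<open>p x zs\<close> vanishes for \<open>x \<notin> \<gg>\<^sub>1\<close>. With this convention distinct cochains are distinct
  elements, and pointwise addition is addition of cochains.\<close>

type_synonym ('g, 'm) cochain = "('g list \<Rightarrow> 'm) \<times> ('g \<Rightarrow> 'g list \<Rightarrow> 'm)"

definition scale_cochain :: "('k \<Rightarrow> 'm \<Rightarrow> 'm) \<Rightarrow> 'k \<Rightarrow> ('g, 'm) cochain \<Rightarrow> ('g, 'm) cochain" where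
  "scale_cochain scaleM a = (\<lambda>(c, p). (\<lambda>zs. scaleM a (c zs), \<lambda>x zs. scaleM a (p x zs)))"

definition alternating_multilinear ::
  "('k::field \<Rightarrow> 'g::ab_group_add \<Rightarrow> 'g) \<Rightarrow> ('k \<Rightarrow> 'm::ab_group_add \<Rightarrow> 'm)
    \<Rightarrow> nat \<Rightarrow> ('g list \<Rightarrow> 'm) \<Rightarrow> bool" where
  "alternating_multilinear scale scaleM k c \<longleftrightarrow>
     (\<forall>zs. length zs \<noteq> k \<longrightarrow> c zs = 0) \<and>
     (\<forall>zs i. length zs = k \<and> i < k \<longrightarrow> Vector_Spaces.linear scale scaleM (\<lambda>v. c (zs[i := v]))) \<and>
     (\<forall>zs i j. length zs = k \<and> i < j \<and> j < k \<and> zs ! i = zs ! j \<longrightarrow> c zs = 0)"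

definition cochain_of_vector :: "'m \<Rightarrow> ('g, 'm::zero) cochain" where
  "cochain_of_vector m = (\<lambda>zs. case zs of [] \<Rightarrow> m | _ \<Rightarrow> 0, \<lambda>x zs. 0)"

definition cochain_of_map :: "('g \<Rightarrow> 'm) \<Rightarrow> ('g, 'm::zero) cochain" where
  "cochain_of_map f = (\<lambda>zs. case zs of [z] \<Rightarrow> f z | _ \<Rightarrow> 0, \<lambda>x zs. 0)"

definition XC :: "('k::field \<Rightarrow> 'g::ab_group_add \<Rightarrow> 'g) \<Rightarrow> 'g set \<Rightarrow> ('k \<Rightarrow> 'm::ab_group_add \<Rightarrow> 'm)
    \<Rightarrow> int \<Rightarrow> ('g, 'm) cochain set" where
  "XC scale g1 scaleM n =
    (if n < 0 then {0}
     else if n = 0 then range cochain_of_vector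
     else if n = 1 then cochain_of_map ` {c. Vector_Spaces.linear scale scaleM c}
     else {(c, p).
        alternating_multilinear scale scaleM (nat n) c \<and>
        (\<forall>x zs. x \<notin> g1 \<longrightarrow> p x zs = 0) \<and>
        (\<forall>x\<in>g1. alternating_multilinear scale scaleM (nat (n - 2)) (p x)) \<and>
        (\<forall>a. \<forall>x\<in>g1. \<forall>zs. int (length zs) = n - 2 \<longrightarrow> p (scale a x) zs = scaleM (a\<^sup>2) (p x zs)) \<and>
        (\<forall>x\<in>g1. \<forall>y\<in>g1. \<forall>zs. int (length zs) = n - 2 \<longrightarrow>
           p (x + y) zs + p x zs + p y zs = c (x # y # zs))})"


section \<open>Differentials\<close>

text \<open>The list \<open>zs\<close> with the entries at the positions in \<open>I\<close> omitted is \<open>nths zs (- I)\<close>;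
  positions are counted from \<open>0\<close>.\<close>

definition d_c :: "('g \<Rightarrow> 'g \<Rightarrow> 'g) \<Rightarrow> ('g \<Rightarrow> 'm \<Rightarrow> 'm) \<Rightarrow> ('g list \<Rightarrow> 'm) \<Rightarrow> 'g list \<Rightarrow> 'm::ab_group_add" where
  "d_c br \<rho> c zs =
     (\<Sum>i<length zs. \<rho> (zs ! i) (c (nths zs (- {i})))) +
     (\<Sum>j<length zs. \<Sum>i<j. c (br (zs ! i) (zs ! j) # nths zs (- {i, j})))"

definition d_p :: "('g \<Rightarrow> 'g \<Rightarrow> 'g) \<Rightarrow> ('g \<Rightarrow> 'g) \<Rightarrow> ('g \<Rightarrow> 'm \<Rightarrow> 'm) \<Rightarrow> ('g list \<Rightarrow> 'm) \<Rightarrow> ('g \<Rightarrow> 'g list \<Rightarrow> 'm)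
    \<Rightarrow> 'g \<Rightarrow> 'g list \<Rightarrow> 'm::ab_group_add" where
  "d_p br s \<rho> c p x zs =
     \<rho> x (c (x # zs)) +
     (\<Sum>i<length zs. \<rho> (zs ! i) (p x (nths zs (- {i})))) +
     c (s x # zs) +
     (\<Sum>i<length zs. c (br x (zs ! i) # x # nths zs (- {i}))) +
     (\<Sum>j<length zs. \<Sum>i<j. p x (br (zs ! i) (zs ! j) # nths zs (- {i, j})))"

definition differential :: "'g set \<Rightarrow> ('g \<Rightarrow> 'g \<Rightarrow> 'g) \<Rightarrow> ('g \<Rightarrow> 'g) \<Rightarrow> ('g \<Rightarrow> 'm \<Rightarrow> 'm)
    \<Rightarrow> int \<Rightarrow> ('g, 'm::ab_group_add) cochain \<Rightarrow> ('g, 'm) cochain" where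
  "differential g1 br s \<rho> n = (\<lambda>(c, p).
    (if n < 0 then 0
     else if n = 0 then cochain_of_map (\<lambda>x. \<rho> x (c []))
     else if n = 1 then
       (\<lambda>zs. case zs of [x, z] \<Rightarrow> c [br x z] + \<rho> x (c [z]) + \<rho> z (c [x]) | _ \<Rightarrow> 0,
        \<lambda>x zs. if x \<in> g1 \<and> zs = [] then c [s x] + \<rho> x (c [x]) else 0)
     else
       (\<lambda>zs. if int (length zs) = n + 1 then d_c br \<rho> c zs else 0,
        \<lambda>x zs. if x \<in> g1 \<and> int (length zs) = n - 1 then d_p br s \<rho> c p x zs else 0)))"


section \<open>Cochain complexes of vector spaces\<close>

text \<open>The terms are subspaces of one ambient vector space, so linearity of \<open>d n\<close> is only required
  on \<open>C n\<close>. Degrees start at \<open>-1\<close>.\<close>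

locale cochain_complex = vector_space scale
  for scale :: "'k::field \<Rightarrow> 'c::ab_group_add \<Rightarrow> 'c" +
  fixes C :: "int \<Rightarrow> 'c set" and d :: "int \<Rightarrow> 'c \<Rightarrow> 'c"
  assumes subspace_C: "n \<ge> - 1 \<Longrightarrow> subspace (C n)"
    and d_closed: "\<lbrakk>n \<ge> - 1; u \<in> C n\<rbrakk> \<Longrightarrow> d n u \<in> C (n + 1)"
    and d_add: "\<lbrakk>n \<ge> - 1; u \<in> C n; v \<in> C n\<rbrakk> \<Longrightarrow> d n (u + v) = d n u + d n v"
    and d_scale: "\<lbrakk>n \<ge> - 1; u \<in> C n\<rbrakk> \<Longrightarrow> d n (scale a u) = scale a (d n u)"
    and d_d: "\<lbrakk>n \<ge> - 1; u \<in> C n\<rbrakk> \<Longrightarrow> d (n + 1) (d n u) = 0"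

end

theory Submission
  imports Defs
begin

text \<open>The proof is a Cartan calculus. For a vector \<open>x\<close> let \<open>\<iota>\<^sub>x c = c(x, -)\<close> be the contraction and
  \<open>L\<^sub>x\<close> the Lie derivative. In characteristic 2 there are no signs: the bracket is symmetric as well
  as alternating, it satisfies the Jacobi identity on all of \<open>\<gg>\<close>, and a cochain may have its
  arguments permuted freely. The Chevalley--Eilenberg differential \<open>d\<close> is then determined by
  \<open>\<iota>\<^sub>x d = L\<^sub>x + d \<iota>\<^sub>x\<close>, and the formula for the second component of the differential of
  \<open>(c, p)\<close> reads, with \<open>p\<^sub>x = p(x, -)\<close>,
  \<open>x \<mapsto> L\<^sub>x \<iota>\<^sub>x c + \<iota>\<^bsub>s(x)\<^esub> c + d p\<^sub>x\<close>.

  Three identities suffice: \<open>[L\<^sub>x, L\<^sub>y] = L\<^bsub>[x,y]\<^esub>\<close> (\<open>lie_br\<close>), \<open>[L\<^sub>x, d] = 0\<close> (\<open>lie_ce_commute\<close>),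
  and \<open>L\<^sub>x\<^sup>2 = L\<^bsub>s(x)\<^esub>\<close> for odd \<open>x\<close> (\<open>lie_squaring\<close>). Each is proved by induction on the number of
  arguments, because a contraction commutes with both sides up to terms that cancel. The first two
  give \<open>d d = 0\<close>. For the second component, expanding with Cartan's formula leaves
  \<open>L\<^sub>x L\<^sub>x c + L\<^bsub>s(x)\<^esub> c\<close>, which vanishes by the third identity. The condition relating \<open>c\<close> and \<open>p\<close>
  is preserved because the polarization of the displayed map is \<open>\<iota>\<^sub>y \<iota>\<^sub>x d c\<close>.

  These formulas hold in every degree \<open>n \<ge> 0\<close>, including the degrees 0 and 1, where cochains and
  differentials are introduced separately (\<open>XC_eq\<close>, \<open>differential_eq_cartan\<close>).\<close>


section \<open>Alternating multilinear maps in characteristic 2\<close>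

locale char_2_vector_space_pair = vector_space_pair scale scaleM
  for scale :: "'k::field \<Rightarrow> 'g::ab_group_add \<Rightarrow> 'g"
    and scaleM :: "'k \<Rightarrow> 'm::ab_group_add \<Rightarrow> 'm" +
  assumes char_2: "CHAR('k) = 2"
begin

lemma one_plus_one: "(1::'k) + 1 = 0"
  by (metis char_2 of_nat_CHAR of_nat_numeral one_add_one)

lemma source_add_self [simp]: "x + x = (0::'g)"
  by (metis one_plus_one vs1.scale_left_distrib vs1.scale_one vs1.scale_zero_left)

lemma target_add_self [simp]: "x + x = (0::'m)"
  by (metis one_plus_one vs2.scale_left_distrib vs2.scale_one vs2.scale_zero_left)

lemma target_add_self_left [simp]: "x + (x + y) = (y::'m)"
  by (simp flip: add.assoc)

lemma source_add_self_left [simp]: "x + (x + y) = (y::'g)"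
  by (simp flip: add.assoc)

lemma target_add_eq_0_iff: "x + y = 0 \<longleftrightarrow> x = (y::'m)"
  by (metis add.commute add_0 target_add_self_left target_add_self)

lemma linearI:
  assumes "\<And>x y. f (x + y) = f x + f y" "\<And>a x. f (scale a x) = scaleM a (f x)"
  shows "Vector_Spaces.linear scale scaleM f"
  using assms by (simp add: Vector_Spaces.linear_iff vs1.vector_space_axioms vs2.vector_space_axioms)

text \<open>Alternation is asked for only in two adjacent arguments: the first two of the map and of its
  iterated contractions. Any two equal arguments can be made adjacent, since such a map is symmetric.
  This form lets the predicate be established one argument at a time, by the recursion on lists
  that also defines the operators below.\<close>

primrec alternating :: "nat \<Rightarrow> ('g list \<Rightarrow> 'm) \<Rightarrow> bool" where
  "alternating 0 c \<longleftrightarrow> (\<forall>zs. zs \<noteq> [] \<longrightarrow> c zs = 0)"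
| "alternating (Suc k) c \<longleftrightarrow>
     c [] = 0 \<and>
     (\<forall>zs. Vector_Spaces.linear scale scaleM (\<lambda>x. c (x # zs))) \<and>
     (\<forall>x zs. c (x # x # zs) = 0) \<and>
     (\<forall>x. alternating k (\<lambda>zs. c (x # zs)))"

lemma alternating_contract:
  "alternating k c \<Longrightarrow> alternating (k - 1) (\<lambda>zs. c (x # zs))"
  by (cases k) auto

lemma alternating_linear_Cons:
  "alternating k c \<Longrightarrow> Vector_Spaces.linear scale scaleM (\<lambda>x. c (x # zs))"
  by (cases k) (auto intro: linearI)

lemma alternating_add_Cons: "alternating k c \<Longrightarrow> c ((x + y) # zs) = c (x # zs) + c (y # zs)"
  using alternating_linear_Cons[of k c zs] by (simp add: Vector_Spaces.linear_iff)

lemma alternating_scale_Cons: "alternating k c \<Longrightarrow> c (scale a x # zs) = scaleM a (c (x # zs))"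
  using alternating_linear_Cons[of k c zs] by (simp add: Vector_Spaces.linear_iff)

lemma alternating_zero_Cons: "alternating k c \<Longrightarrow> c (0 # zs) = 0"
  using alternating_scale_Cons[of k c 0 0 zs] by simp

lemma alternating_diag: "alternating k c \<Longrightarrow> c (x # x # zs) = 0"
  by (cases k) auto

lemma alternating_swap:
  assumes "alternating k c" shows "c (x # y # zs) = c (y # x # zs)"
proof -
  note add = alternating_add_Cons[OF assms] alternating_add_Cons[OF alternating_contract[OF assms]]
  have "c (x # y # zs) + c (y # x # zs) = c ((x + y) # (x + y) # zs)"
    unfolding add by (simp add: alternating_diag[OF assms] add.commute)
  then show ?thesis
    by (simp only: alternating_diag[OF assms] target_add_eq_0_iff)
qed

lemma alternating_support: "alternating k c \<Longrightarrow> length zs \<noteq> k \<Longrightarrow> c zs = 0"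
proof (induction zs arbitrary: k c)
  case Nil
  then show ?case by (cases k) auto
next
  case (Cons z zs)
  show ?case
  proof (cases k)
    case 0
    then show ?thesis using Cons.prems by simp
  next
    case (Suc l)
    then show ?thesis using Cons.IH[of l "\<lambda>zs. c (z # zs)"] Cons.prems by simp
  qed
qed

text \<open>The second occurrence of \<open>x\<close> is reached by swapping the first one past its neighbours.\<close>

lemma alternating_repeated: "alternating k c \<Longrightarrow> x \<in> set zs \<Longrightarrow> c (x # zs) = 0"
proof (induction zs arbitrary: k c)
  case (Cons y zs)
  show ?case
  proof (cases "x = y")
    case True
    then show ?thesis using alternating_diag[OF Cons.prems(1)] by simp
  next
    case False
    then have "c (y # x # zs) = 0"
      using Cons.IH[OF alternating_contract[OF Cons.prems(1)]] Cons.prems(2) by simp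
    then show ?thesis using alternating_swap[OF Cons.prems(1)] by metis
  qed
qed simp

lemma alternating_linear:
  "alternating k c \<Longrightarrow> i < length zs \<Longrightarrow> Vector_Spaces.linear scale scaleM (\<lambda>v. c (zs[i := v]))"
proof (induction zs arbitrary: k c i)
  case (Cons z zs)
  show ?case
  proof (cases i)
    case 0
    then show ?thesis using alternating_linear_Cons[OF Cons.prems(1)] by simp
  next
    case (Suc j)
    then show ?thesis
      using Cons.IH[OF alternating_contract[OF Cons.prems(1)]] Cons.prems(2) by simp
  qed
qed simp

lemma alternating_nth_eq:
  "alternating k c \<Longrightarrow> i < j \<Longrightarrow> j < length zs \<Longrightarrow> zs ! i = zs ! j \<Longrightarrow> c zs = 0"
proof (induction zs arbitrary: k c i j)
  case (Cons z zs)
  obtain j' where j: "j = Suc j'" using Cons.prems(2) by (cases j) auto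
  show ?case
  proof (cases i)
    case 0
    then have "z \<in> set zs" using Cons.prems j by (auto simp: in_set_conv_nth)
    then show ?thesis using alternating_repeated[OF Cons.prems(1)] by simp
  next
    case (Suc i')
    then show ?thesis
      using Cons.IH[OF alternating_contract[OF Cons.prems(1)]] Cons.prems j by simp
  qed
qed simp

lemma alternating_multilinear_contract:
  assumes "alternating_multilinear scale scaleM (Suc k) c"
  shows "alternating_multilinear scale scaleM k (\<lambda>zs. c (x # zs))"
  unfolding alternating_multilinear_def
proof (intro conjI allI impI)
  fix zs :: "'g list" assume "length zs \<noteq> k"
  then show "c (x # zs) = 0" using assms by (simp add: alternating_multilinear_def)
next
  fix zs :: "'g list" and i assume "length zs = k \<and> i < k"
  then have "length (x # zs) = Suc k \<and> Suc i < Suc k" by simp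
  then have "Vector_Spaces.linear scale scaleM (\<lambda>v. c ((x # zs)[Suc i := v]))"
    using assms unfolding alternating_multilinear_def by blast
  then show "Vector_Spaces.linear scale scaleM (\<lambda>v. c (x # zs[i := v]))" by simp
next
  fix zs :: "'g list" and i j assume "length zs = k \<and> i < j \<and> j < k \<and> zs ! i = zs ! j"
  then have "length (x # zs) = Suc k \<and> Suc i < Suc j \<and> Suc j < Suc k
      \<and> (x # zs) ! Suc i = (x # zs) ! Suc j" by simp
  then show "c (x # zs) = 0" using assms unfolding alternating_multilinear_def by blast
qed

lemma alternating_if_alternating_multilinear:
  "alternating_multilinear scale scaleM k c \<Longrightarrow> alternating k c"
proof (induction k arbitrary: c)
  case 0
  then show ?case by (simp add: alternating_multilinear_def)
next
  case (Suc k)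
  note alt = Suc.prems[unfolded alternating_multilinear_def]
  have "Vector_Spaces.linear scale scaleM (\<lambda>x. c (x # zs))" for zs
  proof (cases "length zs = k")
    case True
    then have "length (0 # zs) = Suc k \<and> 0 < Suc k" by simp
    then have "Vector_Spaces.linear scale scaleM (\<lambda>x. c ((0 # zs)[0 := x]))" using alt by blast
    then show ?thesis by simp
  next
    case False
    then show ?thesis using alt by (auto intro: linearI)
  qed
  moreover have "c (x # x # zs) = 0" for x zs
  proof (cases "length (x # x # zs) = Suc k")
    case True
    then have "length (x # x # zs) = Suc k \<and> 0 < Suc 0 \<and> Suc 0 < Suc k
        \<and> (x # x # zs) ! 0 = (x # x # zs) ! Suc 0" by simp
    then show ?thesis using alt by blast
  qed (use alt in blast)
  ultimately show ?case
    using alt Suc.IH[OF alternating_multilinear_contract[OF Suc.prems]] by simp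
qed

lemma alternating_multilinear_iff:
  "alternating_multilinear scale scaleM k c \<longleftrightarrow> alternating k c"
proof
  assume "alternating k c"
  then show "alternating_multilinear scale scaleM k c"
    unfolding alternating_multilinear_def
    using alternating_support alternating_linear alternating_nth_eq by metis
qed (rule alternating_if_alternating_multilinear)

lemma alternating_zero: "alternating k (\<lambda>zs. 0)"
  by (induction k) (auto intro: linearI)

lemma alternating_add:
  "alternating k c \<Longrightarrow> alternating k c' \<Longrightarrow> alternating k (\<lambda>zs. c zs + c' zs)"
proof (induction k arbitrary: c c')
  case (Suc k)
  show ?case
    using Suc.prems Suc.IH
    by (auto intro!: linearI simp: alternating_add_Cons[OF Suc.prems(1)]
        alternating_add_Cons[OF Suc.prems(2)] alternating_scale_Cons[OF Suc.prems(1)]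
        alternating_scale_Cons[OF Suc.prems(2)] vs2.scale_right_distrib add_ac)
qed simp

lemma alternating_scale: "alternating k c \<Longrightarrow> alternating k (\<lambda>zs. scaleM a (c zs))"
proof (induction k arbitrary: c)
  case (Suc k)
  show ?case
    using Suc.prems Suc.IH
    by (auto intro!: linearI simp: alternating_add_Cons[OF Suc.prems(1)]
        alternating_scale_Cons[OF Suc.prems(1)] vs2.scale_right_distrib vs2.scale_left_commute)
qed simp

end


section \<open>The underlying Lie algebra and its representation\<close>

context lie_superalgebra_module
begin

sublocale char_2_vector_space_pair scale scaleM
  by (intro char_2_vector_space_pair.intro vector_space_pair.intro
      char_2_vector_space_pair_axioms.intro vector_space_axioms M.vector_space_axioms char_2)

lemma br_add_right: "br x (y + z) = br x y + br x z"
  and br_scale_right: "br x (scale a y) = scale a (br x y)"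
  using br_linear_right[of x] by (simp_all add: Vector_Spaces.linear_iff)

lemma br_add_left: "br (x + y) z = br x z + br y z"
  and br_scale_left: "br (scale a x) z = scale a (br x z)"
  using br_linear_left[of z] by (simp_all add: Vector_Spaces.linear_iff)

lemma rho_add_right [simp]: "\<rho> x (m + m') = \<rho> x m + \<rho> x m'"
  and rho_scale_right [simp]: "\<rho> x (scaleM a m) = scaleM a (\<rho> x m)"
  using rho_endomorphism[of x] by (simp_all add: Vector_Spaces.linear_iff)

lemma rho_zero_right [simp]: "\<rho> x 0 = 0"
  using rho_scale_right[of x 0 0] by simp

lemma rho_add_left: "\<rho> (x + y) m = \<rho> x m + \<rho> y m"
  and rho_scale_left: "\<rho> (scale a x) m = scaleM a (\<rho> x m)"
  using rho_linear[of m] by (simp_all add: Vector_Spaces.linear_iff)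

lemma odd_add_closed: "x \<in> g1 \<Longrightarrow> y \<in> g1 \<Longrightarrow> x + y \<in> g1"
  and odd_scale_closed: "x \<in> g1 \<Longrightarrow> scale a x \<in> g1"
  using subspace_odd by (auto simp: subspace_def)

lemma squaring_add:
  assumes "x \<in> g1" "y \<in> g1" shows "s (x + y) = br x y + s x + s y"
  using odd_bracket[OF assms] by (simp add: add_ac)

text \<open>For odd \<open>b\<close> the bracket \<open>[b, b]\<close> is \<open>s(2b) + 2s(b)\<close>, and \<open>s(0) = 0\<close> by homogeneity.\<close>

lemma br_self: "br x x = 0"
proof -
  obtain a b where ab: "a \<in> g0" "b \<in> g1" "x = a + b" using sum_even_odd by blast
  have "s (scale 0 b) = 0" using squaring_scale[OF ab(2), of 0] by simp
  then have "br b b = 0" using odd_bracket[OF ab(2) ab(2)] by simp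
  then show ?thesis
    using ab even_alternating action_two_sided by (simp add: br_add_left br_add_right)
qed

lemma br_commute: "br x y = br y x"
proof -
  have "br x y + br y x = br (x + y) (x + y)"
    unfolding br_add_left br_add_right by (simp add: br_self add.commute)
  then have "br x y + br y x = 0" by (simp only: br_self)
  then show ?thesis by (metis add.right_neutral source_add_self_left)
qed

text \<open>For two odd arguments the identity is the polarization of
  \<open>[s(x), y] = [x, [x, y]]\<close>; the third argument may then have either parity.\<close>

lemma jacobi_odd_odd:
  assumes "x \<in> g1" "y \<in> g1"
  shows "br (br x y) z = br x (br y z) + br y (br x z)"
proof -
  have "br (s (x + y)) z = br (x + y) (br (x + y) z)"
    using assms by (intro squaring_bracket odd_add_closed)
  then have "br (br x y) z + br (s x) z + br (s y) z =
      br x (br x z) + br x (br y z) + (br y (br x z) + br y (br y z))"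
    using assms by (simp add: squaring_add br_add_left br_add_right)
  then have "br (br x y) z + (br (s x) z + br (s y) z) =
      (br x (br y z) + br y (br x z)) + (br (s x) z + br (s y) z)"
    using assms by (simp add: squaring_bracket add_ac)
  then show ?thesis by (simp only: add_right_cancel)
qed

lemma minus_eq [simp]: "- (x::'g) = x"
  by (rule minus_unique) simp

text \<open>The Jacobi sum \<open>J\<close> is trilinear and symmetric, so it is enough to treat homogeneous arguments
  up to order: two odd ones, or at most one odd one.\<close>

lemma jacobi: "br (br x y) z = br x (br y z) + br y (br x z)"
proof -
  define J where "J x y z = br x (br y z) + br y (br z x) + br z (br x y)" for x y z
  have rot: "J x y z = J y z x" for x y z by (simp add: J_def add_ac)
  have swap: "J x y z = J y x z" for x y z by (simp add: J_def br_commute add_ac)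
  have J_iff: "J x y z = 0 \<longleftrightarrow> br (br x y) z = br x (br y z) + br y (br x z)" for x y z
    unfolding J_def br_commute[of z x] br_commute[of z "br x y"]
    by (metis add.commute add_0 minus_eq neg_eq_iff_add_eq_0)
  have eee: "J x y z = 0" if "x \<in> g0" "y \<in> g0" "z \<in> g0" for x y z
    using even_jacobi[OF that] by (simp add: J_def)
  have eeo: "J x y z = 0" if "x \<in> g0" "y \<in> g0" "z \<in> g1" for x y z
    using action_module[OF that] by (simp add: J_iff diff_conv_add_uminus)
  have oo: "J x y z = 0" if "x \<in> g1" "y \<in> g1" for x y z
    using jacobi_odd_odd[OF that] by (simp add: J_iff)
  have homogeneous: "J x y z = 0" if "x \<in> g0 \<union> g1" "y \<in> g0 \<union> g1" "z \<in> g0 \<union> g1" for x y z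
    using that eee eeo oo rot by (metis UnE)
  have add: "J (x + x') y z = J x y z + J x' y z" for x x' y z
    by (simp add: J_def br_add_left br_add_right add_ac)
  have add2: "J x (y + y') z = J x y z + J x y' z" for x y y' z
    using add swap by metis
  have add3: "J x y (z + z') = J x y z + J x y z'" for x y z z'
    using add2 rot by metis
  obtain a b where "a \<in> g0" "b \<in> g1" "x = a + b" using sum_even_odd by blast
  moreover obtain a' b' where "a' \<in> g0" "b' \<in> g1" "y = a' + b'" using sum_even_odd by blast
  moreover obtain a'' b'' where "a'' \<in> g0" "b'' \<in> g1" "z = a'' + b''" using sum_even_odd by blast
  ultimately have "J x y z = 0" by (simp add: add add2 add3 homogeneous)
  then show ?thesis by (simp add: J_iff)
qed


section \<open>Cartan calculus\<close>

text \<open>The classical Lie derivative \<open>x \<cdot> c(zs) + \<Sum>\<^sub>i c(z\<^sub>1, \<dots>, [x, z\<^sub>i], \<dots>, z\<^sub>k)\<close>,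
  peeled off one argument at a time. The second equation is the commutation rule
  \<open>\<iota>\<^sub>z L\<^sub>x = L\<^sub>x \<iota>\<^sub>z + \<iota>\<^bsub>[x,z]\<^esub>\<close> with the contraction \<open>\<iota>\<^sub>z c = c(z, -)\<close>.\<close>

fun lie :: "'g \<Rightarrow> ('g list \<Rightarrow> 'm) \<Rightarrow> 'g list \<Rightarrow> 'm" where
  "lie x c [] = \<rho> x (c [])"
| "lie x c (z # zs) = c (br x z # zs) + lie x (\<lambda>ws. c (z # ws)) zs"

text \<open>The Chevalley--Eilenberg differential, defined by Cartan's formula
  \<open>\<iota>\<^sub>z d = L\<^sub>z + d \<iota>\<^sub>z\<close>.\<close>

fun ce :: "('g list \<Rightarrow> 'm) \<Rightarrow> 'g list \<Rightarrow> 'm" where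
  "ce c [] = 0"
| "ce c (z # zs) = lie z c zs + ce (\<lambda>ws. c (z # ws)) zs"

lemma lie_zero [simp]: "lie x (\<lambda>zs. 0) zs = 0"
  by (induction zs) auto

lemma lie_add: "lie x (\<lambda>zs. c zs + c' zs) zs = lie x c zs + lie x c' zs"
  by (induction zs arbitrary: c c') (auto simp: add_ac)

lemma lie_scale: "lie x (\<lambda>zs. scaleM a (c zs)) zs = scaleM a (lie x c zs)"
  by (induction zs arbitrary: c) (auto simp: M.scale_right_distrib)

lemma ce_zero [simp]: "ce (\<lambda>zs. 0) zs = 0"
  by (induction zs) auto

lemma ce_add: "ce (\<lambda>zs. c zs + c' zs) zs = ce c zs + ce c' zs"
  by (induction zs arbitrary: c c') (auto simp: lie_add add_ac)

lemma ce_scale: "ce (\<lambda>zs. scaleM a (c zs)) zs = scaleM a (ce c zs)"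
  by (induction zs arbitrary: c) (auto simp: lie_scale M.scale_right_distrib)

lemma lie_add_vector: "alternating k c \<Longrightarrow> lie (x + y) c zs = lie x c zs + lie y c zs"
proof (induction zs arbitrary: k c)
  case (Cons z zs)
  show ?case
    using Cons.IH[OF alternating_contract[OF Cons.prems]] alternating_add_Cons[OF Cons.prems]
    by (simp add: br_add_left add_ac)
qed (simp add: rho_add_left)

lemma lie_scale_vector: "alternating k c \<Longrightarrow> lie (scale a x) c zs = scaleM a (lie x c zs)"
proof (induction zs arbitrary: k c)
  case (Cons z zs)
  show ?case
    using Cons.IH[OF alternating_contract[OF Cons.prems]] alternating_scale_Cons[OF Cons.prems]
    by (simp add: br_scale_left M.scale_right_distrib)
qed (simp add: rho_scale_left)

lemma alternating_lie: "alternating k c \<Longrightarrow> alternating k (lie x c)"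
proof (induction k arbitrary: c)
  case 0
  have "lie x c zs = 0" if "zs \<noteq> []" for zs
    using that 0 by (cases zs) auto
  then show ?case by simp
next
  case (Suc k)
  note alt = Suc.prems
  have sub: "alternating k (\<lambda>zs. c (z # zs))" for z using alt by simp
  have "Vector_Spaces.linear scale scaleM (\<lambda>z. lie x c (z # zs))" for zs
    by (rule linearI)
      (simp_all add: br_add_right br_scale_right alternating_add_Cons[OF alt]
        alternating_scale_Cons[OF alt] lie_add lie_scale M.scale_right_distrib add_ac)
  moreover have "lie x c (z # z # zs) = 0" for z zs
    by (simp add: alternating_diag[OF alt] alternating_swap[OF alt, of z])
  moreover have "alternating k (\<lambda>zs. lie x c (z # zs))" for z
    using alternating_add[OF sub Suc.IH[OF sub]] by simp
  ultimately show ?case using alt by (simp del: lie.simps(2))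
qed

text \<open>In \<open>d c(x, x, zs)\<close> the term \<open>L\<^sub>x (\<iota>\<^sub>x c)\<close> occurs twice, once from each application
  of Cartan's formula.\<close>

lemma alternating_ce: "alternating k c \<Longrightarrow> alternating (Suc k) (ce c)"
proof (induction k arbitrary: c)
  case 0
  then have contr: "(\<lambda>zs. c (z # zs)) = (\<lambda>zs. 0)" for z by auto
  have lin: "Vector_Spaces.linear scale scaleM (\<lambda>z. ce c (z # zs))" for zs
    by (rule linearI) (simp_all add: contr lie_add_vector[OF 0] lie_scale_vector[OF 0])
  have diag: "ce c (z # z # zs) = 0" for z zs
    using 0 by (simp add: contr)
  have "alternating 0 (\<lambda>zs. ce c (z # zs))" for z
    using alternating_lie[OF 0, of z] by (simp add: contr)
  then show ?case using lin diag by (simp del: ce.simps(2))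
next
  case (Suc k)
  note alt = Suc.prems
  have sub: "alternating k (\<lambda>zs. c (z # zs))" for z using alt by simp
  have lin: "Vector_Spaces.linear scale scaleM (\<lambda>z. ce c (z # zs))" for zs
    by (rule linearI)
      (simp_all add: lie_add_vector[OF alt] lie_scale_vector[OF alt] alternating_add_Cons[OF alt]
        alternating_scale_Cons[OF alt] ce_add ce_scale M.scale_right_distrib add_ac)
  have diag: "ce c (z # z # zs) = 0" for z zs
    by (simp add: br_self alternating_diag[OF alt] alternating_zero_Cons[OF alt])
  have "alternating (Suc k) (\<lambda>zs. ce c (z # zs))" for z
    using alternating_add[OF alternating_lie[OF alt] Suc.IH[OF sub]] by (simp only: ce.simps)
  then show ?case using lin diag by (subst alternating.simps) (simp del: alternating.simps ce.simps(2))
qed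

text \<open>Contracting with \<open>z\<close> commutes with both sides up to the terms
  \<open>\<iota>\<^bsub>[[x,y],z]\<^esub>\<close> and \<open>\<iota>\<^bsub>[x,[y,z]]\<^esub> + \<iota>\<^bsub>[y,[x,z]]\<^esub>\<close>, which agree by the Jacobi identity.\<close>

lemma lie_br:
  "alternating k c \<Longrightarrow> lie (br x y) c zs = lie x (lie y c) zs + lie y (lie x c) zs"
proof (induction zs arbitrary: k c)
  case (Cons z zs)
  show ?case
    using Cons.IH[OF alternating_contract[OF Cons.prems]]
    by (simp add: lie_add jacobi alternating_add_Cons[OF Cons.prems] add_ac)
qed (simp add: rho_bracket)

text \<open>Contracting with \<open>z\<close> turns \<open>L\<^sub>x L\<^sub>x\<close> into
  \<open>L\<^sub>x L\<^sub>x \<iota>\<^sub>z + 2 L\<^sub>x \<iota>\<^bsub>[x,z]\<^esub> + \<iota>\<^bsub>[x,[x,z]]\<^esub>\<close>, where the last term is \<open>\<iota>\<^bsub>[s(x),z]\<^esub>\<close>.\<close>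

lemma lie_squaring:
  "x \<in> g1 \<Longrightarrow> alternating k c \<Longrightarrow> lie (s x) c zs = lie x (lie x c) zs"
proof (induction zs arbitrary: k c)
  case (Cons z zs)
  show ?case
    using Cons.IH[OF Cons.prems(1) alternating_contract[OF Cons.prems(2)]] Cons.prems(1)
    by (simp add: lie_add squaring_bracket add_ac)
qed (simp add: rho_squaring)

text \<open>By Cartan's formula and \<open>[L\<^sub>x, L\<^sub>z] = L\<^bsub>[x,z]\<^esub>\<close>, the commutator \<open>[L\<^sub>x, d]\<close> commutes with every
  contraction, and it vanishes without arguments.\<close>

lemma lie_ce_commute: "alternating k c \<Longrightarrow> lie x (ce c) zs = ce (lie x c) zs"
proof (induction zs arbitrary: k c)
  case (Cons z zs)
  show ?case
    using Cons.IH[OF alternating_contract[OF Cons.prems]]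
    by (simp add: lie_add ce_add lie_br[OF Cons.prems] add_ac)
qed simp

text \<open>Here \<open>\<iota>\<^sub>z d d = L\<^sub>z d + d L\<^sub>z + d d \<iota>\<^sub>z\<close>.\<close>

lemma ce_ce: "alternating k c \<Longrightarrow> ce (ce c) zs = 0"
proof (induction zs arbitrary: k c)
  case (Cons z zs)
  show ?case
    using Cons.IH[OF alternating_contract[OF Cons.prems]]
    by (simp add: ce_add lie_ce_commute[OF Cons.prems])
qed simp


section \<open>Comparison with the formulas with omitted arguments\<close>

lemma nths_Cons_omit:
  "nths (z # zs) (- {0}) = zs"
  "nths (z # zs) (- {Suc i}) = z # nths zs (- {i})"
  "nths (z # zs) (- {0, Suc j}) = nths zs (- {j})"
  "nths (z # zs) (- {Suc i, Suc j}) = z # nths zs (- {i, j})"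
  by (simp_all add: nths_Cons Compl_eq nths_all)

text \<open>Moving \<open>[x, z\<^sub>i]\<close> from position \<open>i\<close> to the front costs no sign in characteristic 2.\<close>

lemma lie_eq_sum:
  "alternating k c \<Longrightarrow>
    lie x c zs = \<rho> x (c zs) + (\<Sum>i<length zs. c (br x (zs ! i) # nths zs (- {i})))"
proof (induction zs arbitrary: k c)
  case (Cons z zs)
  show ?case
    using Cons.IH[OF alternating_contract[OF Cons.prems]]
    by (simp add: sum.lessThan_Suc_shift nths_Cons_omit alternating_swap[OF Cons.prems, of _ z]
        add_ac del: sum.lessThan_Suc)
qed simp

lemma d_c_eq_ce: "alternating k c \<Longrightarrow> d_c br \<rho> c zs = ce c zs"
proof (induction zs arbitrary: k c)
  case Nil
  then show ?case by (simp add: d_c_def)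
next
  case (Cons z zs)
  show ?case
    using Cons.IH[OF alternating_contract[OF Cons.prems], symmetric]
    by (simp add: d_c_def sum.lessThan_Suc_shift nths_Cons_omit lie_eq_sum[OF Cons.prems]
        alternating_swap[OF Cons.prems, of _ z] sum.distrib add_ac del: sum.lessThan_Suc)
qed

lemma d_p_eq:
  assumes "alternating k c" "alternating l (p x)"
  shows "d_p br s \<rho> c p x zs = lie x (\<lambda>ws. c (x # ws)) zs + c (s x # zs) + ce (p x) zs"
  by (simp add: d_p_def d_c_eq_ce[OF assms(2), symmetric] d_c_def
      lie_eq_sum[OF alternating_contract[OF assms(1)]] alternating_swap[OF assms(1), of _ x] add_ac)


section \<open>The cochain complex\<close>

text \<open>One description for all degrees \<open>n \<ge> 0\<close>. In degrees 0 and 1 the second component is zero, so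
  that \<open>alternating (n - 2) (p x)\<close> holds there with the truncated difference \<open>0\<close>. The conditions on
  \<open>p\<close> are imposed on lists of any length, since on lists of the wrong length all terms are zero.\<close>

definition cochains :: "nat \<Rightarrow> ('g, 'm) cochain set" where
  "cochains n = {(c, p).
     alternating n c \<and>
     (\<forall>x. alternating (n - 2) (p x)) \<and>
     (\<forall>x zs. x \<notin> g1 \<or> n < 2 \<longrightarrow> p x zs = 0) \<and>
     (\<forall>a. \<forall>x\<in>g1. \<forall>zs. p (scale a x) zs = scaleM (a\<^sup>2) (p x zs)) \<and>
     (\<forall>x\<in>g1. \<forall>y\<in>g1. \<forall>zs. p (x + y) zs + p x zs + p y zs = c (x # y # zs))}"

lemma XC_0_eq: "XC scale g1 scaleM 0 = cochains 0"
proof -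
  have "(c, p) \<in> range cochain_of_vector \<longleftrightarrow> (c, p) \<in> cochains 0" for c p
  proof
    assume "(c, p) \<in> range cochain_of_vector"
    then show "(c, p) \<in> cochains 0"
      by (auto simp: cochains_def cochain_of_vector_def split: list.split)
  next
    assume "(c, p) \<in> cochains 0"
    then have "(c, p) = cochain_of_vector (c [])"
      by (auto simp: cochains_def cochain_of_vector_def fun_eq_iff split: list.split)
    then show "(c, p) \<in> range cochain_of_vector" by blast
  qed
  then show ?thesis by (auto simp: XC_def)
qed

lemma XC_1_eq: "XC scale g1 scaleM 1 = cochains 1"
proof -
  have "(c, p) \<in> cochain_of_map ` {c. Vector_Spaces.linear scale scaleM c} \<longleftrightarrow>
      (c, p) \<in> cochains 1" for c p
  proof
    assume "(c, p) \<in> cochain_of_map ` {c. Vector_Spaces.linear scale scaleM c}"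
    then obtain f where f: "Vector_Spaces.linear scale scaleM f"
      and c: "c = (\<lambda>zs. case zs of [z] \<Rightarrow> f z | _ \<Rightarrow> 0)" and p: "p = (\<lambda>x zs. 0)"
      by (auto simp: cochain_of_map_def)
    have "Vector_Spaces.linear scale scaleM (\<lambda>x. c (x # zs))" for zs
      using f by (cases zs) (auto simp: c intro: linearI)
    then have "alternating (Suc 0) c" by (auto simp: c split: list.split)
    moreover have "c (x # y # zs) = 0" for x y zs by (simp add: c)
    ultimately show "(c, p) \<in> cochains 1" by (simp add: cochains_def p del: alternating.simps(2))
  next
    assume "(c, p) \<in> cochains 1"
    then have c: "alternating (Suc 0) c" and p: "\<And>x zs. p x zs = 0"
      by (auto simp: cochains_def)
    have "(c, p) = cochain_of_map (\<lambda>x. c [x])"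
      using alternating_support[OF c] p
      by (auto simp: cochain_of_map_def fun_eq_iff split: list.split)
    moreover have "Vector_Spaces.linear scale scaleM (\<lambda>x. c [x])"
      by (rule alternating_linear_Cons[OF c])
    ultimately show "(c, p) \<in> cochain_of_map ` {c. Vector_Spaces.linear scale scaleM c}" by blast
  qed
  then show ?thesis by (auto simp: XC_def)
qed

lemma XC_eq: "XC scale g1 scaleM (int n) = cochains n"
proof -
  consider "n = 0" | "n = 1" | "n \<ge> 2" by linarith
  then show ?thesis
  proof cases
    case 3
    have len: "int (length zs) = int n - 2 \<longleftrightarrow> length zs = n - 2" for zs :: "'g list"
      using 3 by linarith
    have deg: "nat (int n - 2) = n - 2" using 3 by linarith
    have "(c, p) \<in> XC scale g1 scaleM (int n) \<longleftrightarrow> (c, p) \<in> cochains n" for c p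
    proof
      assume "(c, p) \<in> XC scale g1 scaleM (int n)"
      then have c: "alternating n c" and p0: "\<And>x zs. x \<notin> g1 \<Longrightarrow> p x zs = 0"
        and p: "\<And>x. x \<in> g1 \<Longrightarrow> alternating (n - 2) (p x)"
        and psc: "\<And>a x zs. x \<in> g1 \<Longrightarrow> length zs = n - 2 \<Longrightarrow> p (scale a x) zs = scaleM (a\<^sup>2) (p x zs)"
        and padd: "\<And>x y zs. x \<in> g1 \<Longrightarrow> y \<in> g1 \<Longrightarrow> length zs = n - 2 \<Longrightarrow>
          p (x + y) zs + p x zs + p y zs = c (x # y # zs)"
        using 3 by (auto simp: XC_def alternating_multilinear_iff len deg)
      have "alternating (n - 2) (p x)" for x
      proof (cases "x \<in> g1")
        case False
        then have "p x = (\<lambda>zs. 0)" using p0 by auto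
        then show ?thesis using alternating_zero by simp
      qed (rule p)
      moreover have "p (scale a x) zs = scaleM (a\<^sup>2) (p x zs)" if "x \<in> g1" for a x zs
        using that psc alternating_support[OF p] odd_scale_closed
        by (cases "length zs = n - 2") auto
      moreover have "p (x + y) zs + p x zs + p y zs = c (x # y # zs)"
        if "x \<in> g1" "y \<in> g1" for x y zs
        using that padd alternating_support[OF p] odd_add_closed alternating_support[OF c] 3
        by (cases "length zs = n - 2") auto
      ultimately show "(c, p) \<in> cochains n"
        using c p0 3 by (simp add: cochains_def)
    qed (use 3 in \<open>auto simp: XC_def cochains_def alternating_multilinear_iff len deg\<close>)
    then show ?thesis by auto
  qed (simp_all add: XC_0_eq XC_1_eq)
qed

text \<open>The degree does not enter: on a list of the wrong length, every term vanishes because \<open>c\<close> and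
  \<open>p x\<close> are supported on lists of one length.\<close>

definition cartan_differential :: "('g, 'm) cochain \<Rightarrow> ('g, 'm) cochain" where
  "cartan_differential = (\<lambda>(c, p).
     (ce c,
      \<lambda>x zs. if x \<in> g1
        then lie x (\<lambda>ws. c (x # ws)) zs + c (s x # zs) + ce (p x) zs else 0))"

lemma cochains_cartan_odd_part:
  assumes cp: "(c, p) \<in> cochains n"
  shows "alternating (n - 1) (\<lambda>zs. lie x (\<lambda>ws. c (x # ws)) zs + c (s x # zs) + ce (p x) zs)"
    and "n = 0 \<Longrightarrow> lie x (\<lambda>ws. c (x # ws)) zs + c (s x # zs) + ce (p x) zs = 0"
proof -
  have c: "alternating n c" and p: "alternating (n - 2) (p x)" and p0: "n < 2 \<Longrightarrow> p x = (\<lambda>zs. 0)"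
    using cp by (auto simp: cochains_def)
  have sum: "alternating (n - 1) (\<lambda>zs. lie x (\<lambda>ws. c (x # ws)) zs + c (s x # zs))"
    by (intro alternating_add alternating_lie alternating_contract c)
  have "alternating (n - 1) (ce (p x))"
  proof (cases "n < 2")
    case True
    then show ?thesis using p0 alternating_zero by simp
  next
    case False
    then show ?thesis using alternating_ce[OF p] by (simp add: numeral_2_eq_2 Suc_diff_Suc)
  qed
  then show "alternating (n - 1) (\<lambda>zs. lie x (\<lambda>ws. c (x # ws)) zs + c (s x # zs) + ce (p x) zs)"
    by (rule alternating_add[OF sum])
  show "n = 0 \<Longrightarrow> lie x (\<lambda>ws. c (x # ws)) zs + c (s x # zs) + ce (p x) zs = 0"
    using c p0 by simp
qed

lemma differential_eq_cartan:
  assumes u: "u \<in> cochains n"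
  shows "differential g1 br s \<rho> (int n) u = cartan_differential u"
proof -
  obtain c p where cp: "u = (c, p)" by (cases u)
  have c: "alternating n c" and p: "\<And>x. alternating (n - 2) (p x)"
    using u cp by (auto simp: cochains_def)
  note odd = cochains_cartan_odd_part[OF u[unfolded cp]]
  have first: "ce c zs = 0" if "length zs \<noteq> Suc n" for zs
    using alternating_support[OF alternating_ce[OF c] that] .
  have second: "lie x (\<lambda>ws. c (x # ws)) zs + c (s x # zs) + ce (p x) zs = 0"
    if "n = 0 \<or> length zs \<noteq> n - 1" for x zs
    using that odd(2) alternating_support[OF odd(1)] by blast
  consider "n = 0" | "n = 1" | "n \<ge> 2" by linarith
  then show ?thesis
  proof cases
    case 1
    have "cochain_of_map (\<lambda>x. \<rho> x (c [])) = (ce c, \<lambda>x zs. 0)"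
      using first 1 c by (auto simp: cochain_of_map_def fun_eq_iff split: list.split)
    then show ?thesis
      using second 1 by (simp add: cp differential_def cartan_differential_def fun_eq_iff)
  next
    case 2
    have p0: "p x = (\<lambda>zs. 0)" for x using u 2 by (auto simp: cp cochains_def)
    have "(case zs of [x, z] \<Rightarrow> c [br x z] + \<rho> x (c [z]) + \<rho> z (c [x]) | _ \<Rightarrow> 0) = ce c zs" for zs
      using first[of zs] 2 by (auto simp: add_ac split: list.split)
    moreover have "(if zs = [] then c [s x] + \<rho> x (c [x]) else 0) =
        lie x (\<lambda>ws. c (x # ws)) zs + c (s x # zs) + ce (p x) zs" for x zs
      using second[of zs x] 2 by (auto simp: p0 add_ac)
    ultimately show ?thesis
      using 2 by (auto simp: cp differential_def cartan_differential_def fun_eq_iff)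
  next
    case 3
    have len: "int (length zs) = int n + 1 \<longleftrightarrow> length zs = Suc n"
      "int (length zs) = int n - 1 \<longleftrightarrow> length zs = n - 1" for zs :: "'g list"
      using 3 by linarith+
    show ?thesis
      using 3 first second d_c_eq_ce[OF c] d_p_eq[OF c p]
      by (auto simp: cp differential_def cartan_differential_def fun_eq_iff len)
  qed
qed

text \<open>The polarization of \<open>x \<mapsto> L\<^sub>x \<iota>\<^sub>x c + \<iota>\<^bsub>s(x)\<^esub> c + d p\<^sub>x\<close> is
  \<open>L\<^sub>x \<iota>\<^sub>y c + L\<^sub>y \<iota>\<^sub>x c + \<iota>\<^bsub>[x,y]\<^esub> c + d \<iota>\<^sub>y \<iota>\<^sub>x c\<close>, and this is
  \<open>\<iota>\<^sub>y \<iota>\<^sub>x d c\<close> by two applications of Cartan's formula and the rule for \<open>\<iota>\<^sub>y L\<^sub>x\<close>.\<close>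

lemma cartan_differential_closed:
  assumes u: "u \<in> cochains n"
  shows "cartan_differential u \<in> cochains (Suc n)"
proof -
  obtain c p where cp: "u = (c, p)" by (cases u)
  have c: "alternating n c"
    and psc: "\<And>a x zs. x \<in> g1 \<Longrightarrow> p (scale a x) zs = scaleM (a\<^sup>2) (p x zs)"
    and padd: "\<And>x y zs. x \<in> g1 \<Longrightarrow> y \<in> g1 \<Longrightarrow> p (x + y) zs + p x zs + p y zs = c (x # y # zs)"
    using u by (auto simp: cp cochains_def)
  have contr: "alternating (n - 1) (\<lambda>zs. c (x # zs))" for x
    by (rule alternating_contract[OF c])
  \<comment> \<open>the second component of the differential of \<open>(c, p)\<close>\<close>
  define q where "q x zs = (if x \<in> g1
    then lie x (\<lambda>ws. c (x # ws)) zs + c (s x # zs) + ce (p x) zs else 0)" for x zs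
  note odd = cochains_cartan_odd_part[OF u[unfolded cp]]
  have q_alt: "alternating (n - 1) (q x)" for x
    using odd(1)[of x] alternating_zero by (cases "x \<in> g1") (simp_all add: q_def[abs_def])
  have q_scale: "q (scale a x) zs = scaleM (a\<^sup>2) (q x zs)" if x: "x \<in> g1" for a x zs
  proof -
    have "p (scale a x) = (\<lambda>zs. scaleM (a\<^sup>2) (p x zs))" using psc[OF x] by auto
    then show ?thesis
      using x odd_scale_closed[OF x]
      by (simp add: q_def squaring_scale alternating_scale_Cons[OF c] lie_scale
          lie_scale_vector[OF contr] ce_scale M.scale_right_distrib power2_eq_square)
  qed
  have q_add: "q (x + y) zs + q x zs + q y zs = ce c (x # y # zs)"
    if x: "x \<in> g1" and y: "y \<in> g1" for x y zs
  proof -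
    have "p (x + y) zs = p x zs + (p y zs + c (x # y # zs))" for zs
      using padd[OF x y, of zs, symmetric] by (simp add: add_ac)
    then have "p (x + y) = (\<lambda>zs. p x zs + (p y zs + c (x # y # zs)))" by auto
    then show ?thesis
      using x y odd_add_closed[OF x y]
      by (simp add: q_def squaring_add alternating_add_Cons[OF c] lie_add
          lie_add_vector[OF contr] lie_add_vector[OF alternating_add[OF contr contr]] ce_add add_ac)
  qed
  have "q x zs = 0" if "x \<notin> g1 \<or> Suc n < 2" for x zs
    using that odd(2) by (auto simp: q_def)
  then have "(ce c, q) \<in> cochains (Suc n)"
    using alternating_ce[OF c] q_alt q_scale q_add
    by (simp add: cochains_def del: alternating.simps ce.simps lie.simps)
  then show ?thesis
    by (simp add: cp cartan_differential_def q_def[abs_def])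
qed

text \<open>In the second component, \<open>\<iota>\<^sub>x d c\<close> and \<open>\<iota>\<^bsub>s(x)\<^esub> d c\<close> are replaced by Cartan's formula;
  everything cancels except \<open>L\<^sub>x L\<^sub>x c + L\<^bsub>s(x)\<^esub> c = 0\<close>.\<close>

lemma cartan_differential_square:
  assumes u: "u \<in> cochains n"
  shows "cartan_differential (cartan_differential u) = 0"
proof -
  obtain c p where cp: "u = (c, p)" by (cases u)
  have c: "alternating n c" and p: "\<And>x. alternating (n - 2) (p x)"
    using u by (auto simp: cp cochains_def)
  have "lie x (\<lambda>ws. ce c (x # ws)) zs + ce c (s x # zs) +
      ce (\<lambda>zs. lie x (\<lambda>ws. c (x # ws)) zs + c (s x # zs) + ce (p x) zs) zs = 0"
    if "x \<in> g1" for x zs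
    using that
    by (simp add: lie_add ce_add lie_squaring[OF _ c] ce_ce[OF p]
        lie_ce_commute[OF alternating_contract[OF c]] add_ac)
  then show ?thesis
    by (auto simp: cp cartan_differential_def fun_eq_iff zero_prod_def ce_ce[OF c])
qed

lemma cartan_differential_add:
  "cartan_differential (u + v) = cartan_differential u + cartan_differential v"
  by (cases u; cases v)
    (auto simp: cartan_differential_def fun_eq_iff plus_fun_def lie_add ce_add add_ac)

lemma cartan_differential_scale:
  "cartan_differential (scale_cochain scaleM a u) = scale_cochain scaleM a (cartan_differential u)"
  by (cases u)
    (auto simp: cartan_differential_def scale_cochain_def fun_eq_iff lie_scale ce_scale
      M.scale_right_distrib)

sublocale cochain: vector_space "scale_cochain scaleM :: 'k \<Rightarrow> ('g, 'm) cochain \<Rightarrow> _"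
  by unfold_locales
    (auto simp: scale_cochain_def fun_eq_iff M.scale_right_distrib M.scale_left_distrib)

lemma subspace_cochains: "cochain.subspace (cochains n)"
proof (rule cochain.subspaceI)
  show "0 \<in> cochains n"
    using alternating_zero by (auto simp: cochains_def zero_prod_def zero_fun_def)
next
  fix u v assume uv: "u \<in> cochains n" "v \<in> cochains n"
  obtain c p c' p' where cp: "u = (c, p)" "v = (c', p')" by (cases u; cases v)
  have "p (x + y) zs + p' (x + y) zs + (p x zs + p' x zs) + (p y zs + p' y zs) =
      c (x # y # zs) + c' (x # y # zs)" if "x \<in> g1" "y \<in> g1" for x y zs
  proof -
    have "c (x # y # zs) = p (x + y) zs + p x zs + p y zs"
      "c' (x # y # zs) = p' (x + y) zs + p' x zs + p' y zs"
      using uv that by (auto simp: cp cochains_def)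
    then show ?thesis by (simp only: add_ac)
  qed
  then show "u + v \<in> cochains n"
    using uv alternating_add
    by (auto simp: cp cochains_def plus_fun_def M.scale_right_distrib)
next
  fix a u assume u: "u \<in> cochains n"
  obtain c p where cp: "u = (c, p)" by (cases u)
  have "scaleM a (p (x + y) zs) + scaleM a (p x zs) + scaleM a (p y zs) = scaleM a (c (x # y # zs))"
    if "x \<in> g1" "y \<in> g1" for x y zs
    using u that by (auto simp: cp cochains_def simp flip: M.scale_right_distrib)
  then show "scale_cochain scaleM a u \<in> cochains n"
    using u alternating_scale
    by (auto simp: cp cochains_def scale_cochain_def mult.commute)
qed

text \<open>Degree \<open>-1\<close> is the only one to which the uniform description does not apply.\<close>

lemma XC_differential_cases:
  assumes "n \<ge> - 1"
  obtains "n = - 1" "XC scale g1 scaleM n = {0}" "differential g1 br s \<rho> n 0 = 0"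
  | k where "n = int k" "XC scale g1 scaleM n = cochains k"
    "\<And>u. u \<in> cochains k \<Longrightarrow> differential g1 br s \<rho> n u = cartan_differential u"
proof (cases "n = - 1")
  case True
  then show ?thesis
    by (intro that(1)) (auto simp: XC_def differential_def zero_prod_def)
next
  case False
  then have "n = int (nat n)" using assms by simp
  then obtain k where "n = int k" by blast
  then show ?thesis using that(2) XC_eq differential_eq_cartan by blast
qed

end

theorem theorem6p1:
  fixes scale :: "'k::field \<Rightarrow> 'g::ab_group_add \<Rightarrow> 'g"
    and g0 g1 :: "'g set"
    and br :: "'g \<Rightarrow> 'g \<Rightarrow> 'g" and s :: "'g \<Rightarrow> 'g"
    and scaleM :: "'k \<Rightarrow> 'm::ab_group_add \<Rightarrow> 'm"
    and M0 M1 :: "'m set"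
    and \<rho> :: "'g \<Rightarrow> 'm \<Rightarrow> 'm"
  assumes "lie_superalgebra scale g0 g1 br s"
    and "lie_superalgebra_module scale g0 g1 br s scaleM M0 M1 \<rho>"
  shows "(\<forall>n \<ge> - 1. \<forall>u \<in> XC scale g1 scaleM n.
            differential g1 br s \<rho> n u \<in> XC scale g1 scaleM (n + 1)) \<and>
         (\<forall>n \<ge> - 1. \<forall>u \<in> XC scale g1 scaleM n.
            differential g1 br s \<rho> (n + 1) (differential g1 br s \<rho> n u) = 0) \<and>
         cochain_complex (scale_cochain scaleM) (XC scale g1 scaleM) (differential g1 br s \<rho>)"
proof -
  interpret lie_superalgebra_module scale g0 g1 br s scaleM M0 M1 \<rho> by fact
  have closed: "differential g1 br s \<rho> n u \<in> XC scale g1 scaleM (n + 1)"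
    if n: "n \<ge> - 1" and u: "u \<in> XC scale g1 scaleM n" for n u
    using n
  proof (cases rule: XC_differential_cases)
    case 1
    then have "differential g1 br s \<rho> n u = 0" "n + 1 = int 0" using u by auto
    then show ?thesis
      using cochain.subspace_0[OF subspace_cochains[of 0]] by (simp only: XC_eq)
  next
    case (2 k)
    then have "differential g1 br s \<rho> n u \<in> cochains (Suc k)"
      using u cartan_differential_closed by simp
    moreover have "n + 1 = int (Suc k)" using 2 by simp
    ultimately show ?thesis by (simp only: XC_eq)
  qed
  have square: "differential g1 br s \<rho> (n + 1) (differential g1 br s \<rho> n u) = 0"
    if n: "n \<ge> - 1" and u: "u \<in> XC scale g1 scaleM n" for n u
    using n
  proof (cases rule: XC_differential_cases)
    case 1
    then have "differential g1 br s \<rho> n u = 0" "n + 1 = int 0" using u by auto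
    \<comment> \<open>the differential of degree 0 maps zero to zero, by homogeneity with the scalar 0\<close>
    then show ?thesis
      using differential_eq_cartan[OF cochain.subspace_0[OF subspace_cochains[of 0]]]
        cartan_differential_scale[of 0 0]
      by (simp only: cochain.scale_zero_left)
  next
    case (2 k)
    have "n + 1 = int (Suc k)" using 2 by simp
    then have "differential g1 br s \<rho> (n + 1) (cartan_differential u) =
        cartan_differential (cartan_differential u)"
      using u 2 differential_eq_cartan[OF cartan_differential_closed] by (simp add: add_ac)
    then show ?thesis
      using u 2 cartan_differential_square by simp
  qed
  have "cochain_complex (scale_cochain scaleM) (XC scale g1 scaleM) (differential g1 br s \<rho>)"
  proof
    fix n :: int assume n: "n \<ge> - 1"
    show "cochain.subspace (XC scale g1 scaleM n)"
      using n by (cases rule: XC_differential_cases)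
        (simp_all only: subspace_cochains cochain.subspace_single_0)
    fix u assume u: "u \<in> XC scale g1 scaleM n"
    show "differential g1 br s \<rho> n u \<in> XC scale g1 scaleM (n + 1)"
      by (rule closed[OF n u])
    show "differential g1 br s \<rho> (n + 1) (differential g1 br s \<rho> n u) = 0"
      by (rule square[OF n u])
    show "differential g1 br s \<rho> n (scale_cochain scaleM a u) =
        scale_cochain scaleM a (differential g1 br s \<rho> n u)" for a
      using n
    proof (cases rule: XC_differential_cases)
      case 1
      then show ?thesis using u by simp
    next
      case (2 k)
      then show ?thesis
        using u cochain.subspace_scale[OF subspace_cochains] cartan_differential_scale by simp
    qed
    fix v assume v: "v \<in> XC scale g1 scaleM n"
    show "differential g1 br s \<rho> n (u + v) =
        differential g1 br s \<rho> n u + differential g1 br s \<rho> n v"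
      using n
    proof (cases rule: XC_differential_cases)
      case 1
      then show ?thesis using u v by simp
    next
      case (2 k)
      then show ?thesis
        using u v cochain.subspace_add[OF subspace_cochains] cartan_differential_add by simp
    qed
  qed
  then show ?thesis using closed square by blast
qed

end
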